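(* Let $W\colon\mathrm{GL}^+(2)\to\mathbb{R}$ be conformally invariant and satisfy the Grötzsch property, for all rectangles $\mathcal{Q}=[0,a_1]\times[0,a_2]$ and $\mathcal{Q}'=[0,a_1']\times[0,a_2']$. Then $W$ is polyconvex.
   Context: $\mathrm{GL}^+(2)$ is the group of real $2\times2$ matrices with positive determinant. A function $W\colon\mathrm{GL}^+(2)\to\mathbb{R}$ is conformally invariant if $W(AFB)=W(F)$ for all $F\in\mathrm{GL}^+(2)$ and all $A,B\in\mathrm{CSO}(2)=\{aR\mid a\in(0,\infty),\ R\in\mathrm{SO}(2)\}$. $W$ is polyconvex if there is a convex function $P\colon\mathbb{R}^{2\times2}\times\mathbb{R}\cong\mathbb{R}^5\to\mathbb{R}\cup\{+\infty\}$ with $W(F)=P(F,\det F)$ for all $F\in\mathrm{GL}^+(2)$. Grötzsch property (in dimension $n=2$): a conformally invariant $W$ satisfies the Grötzsch property if for every $\mathcal{Q}=[0,a_1]\times[0,a_2]\subset\mathbb{R}^2$ and every $\mathcal{Q}'=[0,a_1']\times[0,a_2']\subset\mathbb{R}^2$ (with $a_i,a_i'>0$), the functional $$I\colon\mathcal{A}\to\mathbb{R},\qquad I(\varphi)=\int_{\mathcal{Q}}W(\nabla\varphi)\,dx$$ attains its minimum at the affine mapping $\varphi\colon\mathcal{Q}\to\mathcal{Q}'$, $\varphi(x)=\left(\frac{a_1'}{a_1}x_1,\frac{a_2'}{a_2}x_2\right)$. Here the set $\mathcal{A}$ of admissible functions consists of all $\varphi\in W^{1,p}_{\mathrm{loc}}(\mathcal{Q};\mathcal{Q}')$,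 $p\ge2$, with $\det\nabla\varphi>0$ that satisfy the Grötzsch boundary conditions, i.e. map each side (one-dimensional face) of $\mathcal{Q}$ to the corresponding side of $\mathcal{Q}'$ (the side $\{x_i=0\}$ to the side $\{x_i=0\}$ and the side $\{x_i=a_i\}$ to the side $\{x_i=a_i'\}$, $i=1,2$). The admissible mappings need not be affine on the boundary. *)

theory Defs
  imports "HOL-Analysis.Analysis"
begin

subsection \<open>Test functions and local Sobolev spaces\<close>

definition partial_deriv :: "'n \<Rightarrow> (real^'n \<Rightarrow> real) \<Rightarrow> real^'n \<Rightarrow> real" where
  "partial_deriv j f x = frechet_derivative f (at x) (axis j 1)"

primrec C_k :: "nat \<Rightarrow> (real^'n \<Rightarrow> real) \<Rightarrow> bool" where
  "C_k 0 f = continuous_on UNIV f"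
| "C_k (Suc k) f = (f differentiable_on UNIV \<and> (\<forall>j. C_k k (partial_deriv j f)))"

definition test_function :: "(real^'n) set \<Rightarrow> (real^'n \<Rightarrow> real) \<Rightarrow> bool" where
  "test_function U \<eta> \<longleftrightarrow>
     (\<forall>k. C_k k \<eta>) \<and> compact (closure {x. \<eta> x \<noteq> 0}) \<and> closure {x. \<eta> x \<noteq> 0} \<subseteq> U"

definition Lp_loc :: "real \<Rightarrow> (real^'n) set \<Rightarrow> (real^'n \<Rightarrow> 'b::euclidean_space) \<Rightarrow> bool" where
  "Lp_loc p U f \<longleftrightarrow>
     set_borel_measurable lebesgue U f \<and>
     (\<forall>K. compact K \<and> K \<subseteq> U \<longrightarrow> set_integrable lebesgue K (\<lambda>x. norm (f x) powr p))"

text \<open>Entry \<open>(i, j)\<close> of \<open>G\<close> is the weak derivative of the \<open>i\<close>-th component in direction \<open>j\<close>.\<close>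

definition weak_gradient ::
    "(real^'n) set \<Rightarrow> (real^'n \<Rightarrow> real^'m) \<Rightarrow> (real^'n \<Rightarrow> real^'n^'m) \<Rightarrow> bool" where
  "weak_gradient U \<phi> G \<longleftrightarrow>
     (\<forall>\<eta> i j. test_function U \<eta> \<longrightarrow>
        (LINT x:U|lebesgue. \<phi> x $ i * partial_deriv j \<eta> x) =
        - (LINT x:U|lebesgue. G x $ i $ j * \<eta> x))"

text \<open>
  \<open>\<phi>\<close> lies in \<open>W\<^sup>1\<^sup>,\<^sup>p\<close>, locally on the open set \<open>U\<close>, and \<open>G\<close> is (a representative of) its
  weak gradient.
\<close>

definition sobolev_loc ::
    "real \<Rightarrow> (real^'n) set \<Rightarrow> (real^'n \<Rightarrow> real^'m) \<Rightarrow> (real^'n \<Rightarrow> real^'n^'m) \<Rightarrow> bool" where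
  "sobolev_loc p U \<phi> G \<longleftrightarrow> Lp_loc p U \<phi> \<and> Lp_loc p U G \<and> weak_gradient U \<phi> G"


subsection \<open>Energy functions on \<open>GL\<^sup>+(2)\<close>\<close>

text \<open>
  An energy function is a total function on all matrices, of which only the values on
  \<open>GL_plus\<close> matter (weak gradients are in \<open>GL_plus\<close> up to a null set).
\<close>

definition GL_plus :: "(real^2^2) set" where
  "GL_plus = {F. det F > 0}"

definition CSO :: "(real^2^2) set" where
  "CSO = {a *\<^sub>R R | a R. a > 0 \<and> rotation_matrix R}"

definition conformally_invariant :: "(real^2^2 \<Rightarrow> real) \<Rightarrow> bool" where
  "conformally_invariant W \<longleftrightarrow>
     (\<forall>F\<in>GL_plus. \<forall>A\<in>CSO. \<forall>B\<in>CSO. W (A ** F ** B) = W F)"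

text \<open>
  Convexity for functions with values in \<open>\<real> \<union> {+\<infinity>}\<close>; there \<open>0 * \<infinity> = 0\<close>, so the end points
  \<open>t = 0\<close> and \<open>t = 1\<close> are harmless.
\<close>

definition ereal_convex :: "('a::real_vector \<Rightarrow> ereal) \<Rightarrow> bool" where
  "ereal_convex P \<longleftrightarrow>
     (\<forall>x. P x \<noteq> -\<infinity>) \<and>
     (\<forall>x y. \<forall>t\<in>{0..1}.
        P ((1 - t) *\<^sub>R x + t *\<^sub>R y) \<le> ereal (1 - t) * P x + ereal t * P y)"

definition polyconvex :: "(real^2^2 \<Rightarrow> real) \<Rightarrow> bool" where
  "polyconvex W \<longleftrightarrow>
     (\<exists>P :: (real^2^2) \<times> real \<Rightarrow> ereal.
        ereal_convex P \<and> (\<forall>F\<in>GL_plus. ereal (W F) = P (F, det F)))"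


subsection \<open>The Groetzsch property\<close>

text \<open>
  The rectangle \<open>[0, a\<^sub>1] \<times> [0, a\<^sub>2]\<close> is \<open>cbox 0 a\<close> for \<open>a :: real^2\<close>.  The condition on the sides
  is a pointwise one, so admissible maps are required to be continuous up to the boundary of the
  rectangle; without this the boundary values would be unrelated to those in the interior.
\<close>

definition admissible ::
    "real \<Rightarrow> real^2 \<Rightarrow> real^2 \<Rightarrow> (real^2 \<Rightarrow> real^2) \<Rightarrow> (real^2 \<Rightarrow> real^2^2) \<Rightarrow> bool" where
  "admissible p a a' \<phi> G \<longleftrightarrow>
     sobolev_loc p (box 0 a) \<phi> G \<and>
     continuous_on (cbox 0 a) \<phi> \<and>
     \<phi> ` cbox 0 a \<subseteq> cbox 0 a' \<and>
     (AE x in lebesgue. x \<in> box 0 a \<longrightarrow> det (G x) > 0) \<and>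
     (\<forall>i. \<phi> ` {x \<in> cbox 0 a. x $ i = 0} \<subseteq> {y \<in> cbox 0 a'. y $ i = 0} \<and>
          \<phi> ` {x \<in> cbox 0 a. x $ i = a $ i} \<subseteq> {y \<in> cbox 0 a'. y $ i = a' $ i})"

definition affine_stretch :: "real^2 \<Rightarrow> real^2 \<Rightarrow> real^2 \<Rightarrow> real^2" where
  "affine_stretch a a' x = (\<chi> i. a' $ i / a $ i * x $ i)"

text \<open>
  The next lemmas show that the affine map, together with its classical gradient, is admissible,
  so that it is a genuine competitor in the minimization below.
\<close>

lemma integral_dir_deriv_zero:
  fixes g :: "real^'n \<Rightarrow> real"
  assumes d: "\<And>x t. ((\<lambda>t. g (x + t *\<^sub>R v)) has_real_derivative g' (x + t *\<^sub>R v)) (at t)"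
    and cg: "continuous_on UNIV g" and c: "continuous_on UNIV g'"
    and z: "\<And>x. norm x > R \<Longrightarrow> g x = 0" and z': "\<And>x. norm x > R \<Longrightarrow> g' x = 0"
  shows "integral\<^sup>L lborel g' = 0"
proof -
  have "compact (g' ` cball 0 R)" 
    by (intro compact_continuous_image continuous_on_subset[OF c]) auto
  then obtain B where B: "\<And>x. norm x \<le> R \<Longrightarrow> \<bar>g' x\<bar> \<le> B"
    by (force dest!: compact_imp_bounded simp: bounded_iff)
  define C where "C = max B 0"
  have C: "\<bar>g' x\<bar> \<le> C" for x using B[of x] z'[of x] by (cases "norm x \<le> R") (auto simp: C_def)
  have C0: "C \<ge> 0" by (simp add: C_def)
  have ig: "integrable lborel g"
  proof -
    have "integrable lborel (\<lambda>x. indicator (cball 0 R) x *\<^sub>R g x)"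
      using borel_integrable_compact[of "cball 0 R" g] continuous_on_subset[OF cg]
      by (simp add: indicator_scaleR_eq_if if_distrib cong: if_cong)
    also have "(\<lambda>x. indicator (cball 0 R) x *\<^sub>R g x) = g"
      using z by (force simp: indicator_def fun_eq_iff)
    finally show ?thesis .
  qed
  have mg: "g \<in> borel_measurable borel" using cg by (rule borel_measurable_continuous_onI)
  have shift: "integrable lborel (\<lambda>x. g (x + w))" "(LINT x|lborel. g (x + w)) = integral\<^sup>L lborel g" for w
  proof -
    have e: "lborel = distr lborel borel (\<lambda>x. w + x)" by (metis lborel_distr_plus)
    show "(LINT x|lborel. g (x + w)) = integral\<^sup>L lborel g"
      by (subst (2) e, subst integral_distr) (use mg in \<open>auto simp: add.commute\<close>)
    show "integrable lborel (\<lambda>x. g (x + w))"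
      using ig by (subst (asm) e, subst (asm) integrable_distr_eq) (use mg in \<open>auto simp: add.commute\<close>)
  qed
  define s where "s n x = real (Suc n) * (g (x + (1 / real (Suc n)) *\<^sub>R v) - g x)" for n x
  have s0: "integral\<^sup>L lborel (s n) = 0" for n
    unfolding s_def using shift ig by simp
  have bd: "norm (s n x) \<le> C * indicator (cball 0 (R + norm v)) x" for n x
  proof (cases "norm x \<le> R + norm v")
    case True
    define h where "h = 1 / real (Suc n)"
    have h: "h > 0" by (simp add: h_def)
    obtain t where "g (x + h *\<^sub>R v) - g (x + 0 *\<^sub>R v) = (h - 0) * g' (x + t *\<^sub>R v)"
      using MVT2[of 0 h "\<lambda>t. g (x + t *\<^sub>R v)" "\<lambda>t. g' (x + t *\<^sub>R v)"] d h by auto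
    then have "s n x = g' (x + t *\<^sub>R v)" unfolding s_def h_def[symmetric] by (simp add: h_def)
    then show ?thesis using C True by simp
  next
    case False
    have "norm ((1 / real (Suc n)) *\<^sub>R v) \<le> norm v" by (simp add: divide_le_eq mult_le_cancel_left1)
    then have "norm (x + (1 / real (Suc n)) *\<^sub>R v) > R"
      using False norm_diff_ineq[of x "(1 / real (Suc n)) *\<^sub>R v"] by linarith
    moreover have "norm x > R" using False norm_ge_zero[of v] by linarith
    ultimately have "s n x = 0" using z by (simp add: s_def)
    then show ?thesis using False C0 by simp
  qed
  have lim: "(\<lambda>n. s n x) \<longlonglongrightarrow> g' x" for x
  proof -
    have "((\<lambda>h. (g (x + h *\<^sub>R v) - g x) / h) \<longlongrightarrow> g' x) (at 0)"
      using d[of x 0] by (simp add: DERIV_def)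
    moreover have "filterlim (\<lambda>n. 1 / real (Suc n)) (at 0) sequentially"
      using LIMSEQ_inverse_real_of_nat by (auto simp: filterlim_at inverse_eq_divide)
    ultimately have "(\<lambda>n. (g (x + (1 / real (Suc n)) *\<^sub>R v) - g x) / (1 / real (Suc n))) \<longlonglongrightarrow> g' x"
      by (rule filterlim_compose)
    then show ?thesis by (simp add: s_def mult.commute)
  qed
  have "(\<lambda>n. integral\<^sup>L lborel (s n)) \<longlonglongrightarrow> integral\<^sup>L lborel g'"
  proof (rule integral_dominated_convergence)
    show "integrable lborel (\<lambda>x::real^'n. C * indicator (cball 0 (R + norm v)) x)"
      by (intro integrable_mult_right integrable_real_indicator emeasure_bounded_finite) auto
    show "g' \<in> borel_measurable lborel" using c by (simp add: borel_measurable_continuous_onI)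
    show "s n \<in> borel_measurable lborel" for n
      unfolding s_def using shift(1) ig by (auto dest: borel_measurable_integrable)
    show "AE x in lborel. (\<lambda>n. s n x) \<longlonglongrightarrow> g' x" using lim by simp
    show "AE x in lborel. norm (s n x) \<le> C * indicator (cball 0 (R + norm v)) x" for n
      using bd by simp
  qed
  with s0 show ?thesis by (simp add: LIMSEQ_const_iff)
qed

lemma test_function_line_deriv:
  assumes "test_function U \<eta>"
  shows "((\<lambda>t. \<eta> (x + t *\<^sub>R axis j 1)) has_real_derivative partial_deriv j \<eta> (x + t *\<^sub>R axis j 1)) (at t)"
proof -
  have "C_k (Suc 0) \<eta>" using assms unfolding test_function_def by blast
  then have "(\<eta> has_derivative frechet_derivative \<eta> (at y)) (at y)" for y
    by (simp add: differentiable_on_def frechet_derivative_works)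
  note D = this[of "x + t *\<^sub>R axis j 1"]
  have "((\<lambda>t. \<eta> (x + t *\<^sub>R axis j 1)) has_derivative
     (\<lambda>h. frechet_derivative \<eta> (at (x + t *\<^sub>R axis j 1)) (h *\<^sub>R axis j 1))) (at t)"
    by (rule has_derivative_compose[where f = "\<lambda>t. x + t *\<^sub>R axis j 1" and g = \<eta> and x = t, OF _ D])
      (auto intro!: derivative_eq_intros)
  moreover have "linear (frechet_derivative \<eta> (at (x + t *\<^sub>R axis j 1)))"
    using D has_derivative_linear by blast
  ultimately show ?thesis
    by (simp add: has_field_derivative_def partial_deriv_def linear_cmul mult_commute_abs)
qed

lemma weak_gradient_linear:
  fixes L :: "real^'n \<Rightarrow> real^'m"
  assumes L: "linear L" and U: "open U"
  shows "weak_gradient U L (\<lambda>_. matrix L)"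
  unfolding weak_gradient_def
proof (intro allI impI)
  fix \<eta> :: "real^'n \<Rightarrow> real" and i j
  assume t: "test_function U \<eta>"
  let ?D = "partial_deriv j \<eta>" and ?c = "matrix L $ i $ j"
  have "C_k (Suc 0) \<eta>" "C_k 0 \<eta>" using t unfolding test_function_def by blast+
  then have ce: "continuous_on UNIV \<eta>" and cD: "continuous_on UNIV ?D" by auto
  define S where "S = closure {x. \<eta> x \<noteq> 0}"
  have S: "compact S" "S \<subseteq> U" using t by (auto simp: test_function_def S_def)
  have z: "\<eta> x = 0" if "x \<notin> S" for x 
    using that closure_subset[of "{x. \<eta> x \<noteq> 0}"] unfolding S_def by blast
  have zD: "?D x = 0" if "x \<notin> S" for x
  proof -
    have "((\<lambda>_. 0) has_derivative (\<lambda>_. 0)) (at x)" by (rule has_derivative_const)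
    moreover have "open (- S)" unfolding S_def by (intro open_Compl closed_closure)
    moreover have "x \<in> - S" using that by simp
    ultimately have "(\<eta> has_derivative (\<lambda>_. 0)) (at x)"
      by (rule has_derivative_transform_within_open) (use z in force)
    then show ?thesis by (simp add: partial_deriv_def frechet_derivative_at[symmetric])
  qed
  obtain R where R: "\<And>x. x \<in> S \<Longrightarrow> norm x \<le> R"
    using compact_imp_bounded[OF S(1)] by (auto simp: bounded_iff)
  have Lc: "continuous_on UNIV L"
    using L by (simp add: linear_continuous_on linear_conv_bounded_linear)
  let ?h = "\<lambda>x. L x $ i * \<eta> x" and ?h' = "\<lambda>x. L x $ i * ?D x + ?c * \<eta> x"
  have int: "integrable lborel f" if "continuous_on UNIV f" "\<And>x. norm x > R \<Longrightarrow> f x = 0" for f :: "real^'n \<Rightarrow> real"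
  proof -
    have "integrable lborel (\<lambda>x. indicator (cball 0 R) x *\<^sub>R f x)"
      using borel_integrable_compact[of "cball 0 R" f] continuous_on_subset[OF that(1)]
      by (simp add: indicator_scaleR_eq_if if_distrib cong: if_cong)
    also have "(\<lambda>x. indicator (cball 0 R) x *\<^sub>R f x) = f"
      using that(2) by (force simp: indicator_def fun_eq_iff)
    finally show ?thesis .
  qed
  have z2: "\<eta> x = 0" "?D x = 0" if "norm x > R" for x using z zD R that by force+
  have "integral\<^sup>L lborel ?h' = 0"
  proof (rule integral_dir_deriv_zero[where g = ?h and v = "axis j 1" and R = R])
    show "((\<lambda>t. ?h (x + t *\<^sub>R axis j 1)) has_real_derivative ?h' (x + t *\<^sub>R axis j 1)) (at t)" for x t
    proof -
      have "(\<lambda>t. L (x + t *\<^sub>R axis j 1) $ i) = (\<lambda>t. L x $ i + t * ?c)"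
        by (simp add: linear_add[OF L] linear_cmul[OF L] matrix_def)
      then have "((\<lambda>t. L (x + t *\<^sub>R axis j 1) $ i) has_real_derivative ?c) (at t)"
        by (auto intro!: derivative_eq_intros)
      from DERIV_mult[OF this test_function_line_deriv[OF t]] show ?thesis
        by (simp add: algebra_simps)
    qed
    show "continuous_on UNIV ?h" "continuous_on UNIV ?h'"
      by (intro continuous_intros ce cD Lc)+
  qed (auto simp: z2)
  moreover have i1: "integrable lborel (\<lambda>x. L x $ i * ?D x)"
    by (intro int continuous_intros cD Lc) (auto simp: z2)
  moreover have i2: "integrable lborel (\<lambda>x. ?c * \<eta> x)"
    by (intro int continuous_intros ce) (auto simp: z2)
  ultimately have *: "(LINT x|lborel. L x $ i * ?D x) = - (LINT x|lborel. ?c * \<eta> x)"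
    by simp
  have "(LINT x:U|lebesgue. L x $ i * ?D x) = (LINT x|lebesgue. L x $ i * ?D x)"
    unfolding set_lebesgue_integral_def using S(2) zD
    by (intro Bochner_Integration.integral_cong) (auto simp: indicator_def)
  moreover have "(LINT x:U|lebesgue. ?c * \<eta> x) = (LINT x|lebesgue. ?c * \<eta> x)"
    unfolding set_lebesgue_integral_def using S(2) z
    by (intro Bochner_Integration.integral_cong) (auto simp: indicator_def)
  ultimately show "(LINT x:U|lebesgue. L x $ i * ?D x) = - (LINT x:U|lebesgue. ?c * \<eta> x)"
    using * integral_completion[OF borel_measurable_integrable[OF i1]]
      integral_completion[OF borel_measurable_integrable[OF i2]] by linarith
qed

lemma Lp_loc_continuous:
  fixes f :: "real^'n \<Rightarrow> 'b::euclidean_space"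
  assumes "continuous_on UNIV f" "open U" "p > 0"
  shows "Lp_loc p U f"
  unfolding Lp_loc_def
proof (intro conjI allI impI)
  have "f \<in> borel_measurable lebesgue"
    using borel_measurable_continuous_onI[OF assms(1)] by (simp add: measurable_completion)
  then show "set_borel_measurable lebesgue U f"
    unfolding set_borel_measurable_def using assms(2)
    by (intro borel_measurable_scaleR borel_measurable_indicator) auto
next
  fix K assume K: "compact K \<and> K \<subseteq> U"
  have "continuous_on UNIV (\<lambda>x. norm (f x) powr p)"
    using assms by (intro continuous_on_powr' continuous_intros) auto
  then have "integrable lborel (\<lambda>x. indicator K x *\<^sub>R (norm (f x) powr p))"
    using borel_integrable_compact[of K "\<lambda>x. norm (f x) powr p"] K
    by (simp add: indicator_scaleR_eq_if if_distrib continuous_on_subset cong: if_cong)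
  then show "set_integrable lebesgue K (\<lambda>x. norm (f x) powr p)"
    unfolding set_integrable_def
    by (subst integrable_completion) (auto dest: borel_measurable_integrable)
qed

lemma admissible_affine_stretch:
  assumes a: "\<And>i. a $ i > 0" and a': "\<And>i. a' $ i > 0" and p: "p > 0"
  shows "admissible p a a' (affine_stretch a a') (\<lambda>_. matrix (affine_stretch a a'))"
proof -
  let ?L = "affine_stretch a a'"
  have L: "linear ?L"
    by (intro linearI) (auto simp: affine_stretch_def vec_eq_iff algebra_simps add_divide_distrib)
  have Lc: "continuous_on UNIV ?L"
    using L by (simp add: linear_continuous_on linear_conv_bounded_linear)
  have le: "a' $ i / a $ i * x \<le> a' $ i" if "x \<le> a $ i" for i x
    using a[of i] a'[of i] that by (simp add: field_simps)
  have ge: "0 \<le> a' $ i / a $ i * x" if "0 \<le> x" for i x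
    using a[of i] a'[of i] that by simp
  have ne: "a $ i \<noteq> 0" for i using a[of i] by simp
  have im: "?L x \<in> cbox 0 a'" if "x \<in> cbox 0 a" for x
    using that le ge by (auto simp: mem_box_cart affine_stretch_def)
  have "det (matrix ?L) = a' $ 1 / a $ 1 * (a' $ 2 / a $ 2)"
    by (simp add: det_2 matrix_def affine_stretch_def axis_def)
  then have det: "det (matrix ?L) > 0" using a a' by simp
  show ?thesis
    unfolding admissible_def sobolev_loc_def
  proof (intro conjI allI)
    show "Lp_loc p (box 0 a) ?L" "Lp_loc p (box 0 a) (\<lambda>_. matrix ?L)"
      by (intro Lp_loc_continuous Lc continuous_on_const open_box p)+
    show "weak_gradient (box 0 a) ?L (\<lambda>_. matrix ?L)"
      by (intro weak_gradient_linear L open_box)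
    show "continuous_on (cbox 0 a) ?L" using Lc by (rule continuous_on_subset) simp
    show "?L ` cbox 0 a \<subseteq> cbox 0 a'" using im by blast
    show "AE x in lebesgue. x \<in> box 0 a \<longrightarrow> det (matrix ?L) > 0" using det by simp
    fix i
    have "?L x $ i = 0" if "x $ i = 0" for x using that by (simp add: affine_stretch_def)
    then show "?L ` {x \<in> cbox 0 a. x $ i = 0} \<subseteq> {y \<in> cbox 0 a'. y $ i = 0}" using im by blast
    have "?L x $ i = a' $ i" if "x $ i = a $ i" for x
      using that ne[of i] by (simp add: affine_stretch_def)
    then show "?L ` {x \<in> cbox 0 a. x $ i = a $ i} \<subseteq> {y \<in> cbox 0 a'. y $ i = a' $ i}"
      using im by blast
  qed
qed


text \<open>
  The functional is evaluated at pairs \<open>(\<phi>, G)\<close> of a map and a representative of its weak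
  gradient; as \<open>G\<close> is unique up to null sets, this amounts to a functional of \<open>\<phi>\<close>.  It is
  real-valued only where the energy density is integrable, and the minimum is taken over these
  maps (a Bochner integral of a non-integrable function would be \<open>0\<close>).
\<close>

definition groetzsch_property :: "real \<Rightarrow> (real^2^2 \<Rightarrow> real) \<Rightarrow> bool" where
  "groetzsch_property p W \<longleftrightarrow>
     (\<forall>a a'. (\<forall>i. a $ i > 0) \<and> (\<forall>i. a' $ i > 0) \<longrightarrow>
        is_arg_min
          (\<lambda>(\<phi>, G). LINT x:cbox 0 a|lebesgue. W (G x))
          (\<lambda>(\<phi>, G). admissible p a a' \<phi> G \<and> set_integrable lebesgue (cbox 0 a) (\<lambda>x. W (G x)))
          (affine_stretch a a', \<lambda>_. matrix (affine_stretch a a')))"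

end

theory Submission
  imports Defs
begin

text \<open>
  Up to multiplication by conformal matrices on both sides, every \<open>F\<close> with positive determinant is
  a stretch \<open>diag(t, 1)\<close>, where \<open>t \<ge> 1\<close> is the ratio of the singular values of \<open>F\<close>
  (\<open>conformal_normal_form\<close>).  So a conformally invariant \<open>W\<close> is determined by
  \<open>h(t) = W(diag(t, 1))\<close>, and \<open>h(1/t) = h(t)\<close>, since conjugating with a quarter turn and rescaling
  turns \<open>diag(t, 1)\<close> into \<open>diag(1/t, 1)\<close>.

  The Groetzsch property makes \<open>h\<close> convex on the positive reals (\<open>groetzsch_stretch_convex\<close>).
  Because it allows maps which are not affine on the boundary, the unit square may be
  mapped to a rectangle by \<open>(x\<^sub>1, x\<^sub>2) \<mapsto> (k(x\<^sub>1), x\<^sub>2)\<close>, where \<open>k\<close> has slope \<open>s\<close> on \<open>[0, \<theta>]\<close> and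
  slope \<open>t\<close> on \<open>[\<theta>, 1]\<close>.  The energy of this map is \<open>\<theta> h(s) + (1 - \<theta>) h(t)\<close> and the energy of the
  affine map is \<open>h(\<theta> s + (1 - \<theta>) t)\<close>; comparing the two is the convexity inequality.  Nothing is
  known about the measurability of \<open>W\<close>, which is why the competitor has only two gradients.

  Finally, convexity together with \<open>h(1/t) = h(t)\<close> forces \<open>h\<close> to be nondecreasing on \<open>[1, \<infinity>)\<close>, and the
  ratio of the singular values of \<open>F\<close> is \<open>\<sigma>(F)\<^sup>2 / det F\<close> with \<open>\<sigma>\<close> the operator norm.  As
  \<open>(F, d) \<mapsto> \<sigma>(F)\<^sup>2 / d\<close> is convex for \<open>d > 0\<close>, its composition with the nondecreasing convex
  function \<open>x \<mapsto> h(max 1 x)\<close> is convex, and \<open>W\<close> is polyconvex (\<open>polyconvex_if_stretch_convex\<close>).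
\<close>

section \<open>Conformal normal form of a planar matrix\<close>

text \<open>Multiplication by \<open>c\<close>, on the plane identified with the complex numbers.\<close>

definition conf :: "complex \<Rightarrow> real^2^2" where
  "conf c = vector [vector [Re c, - Im c], vector [Im c, Re c]]"

definition stretch :: "real \<Rightarrow> real^2^2" where
  "stretch t = vector [vector [t, 0], vector [0, 1]]"

text \<open>
  With the plane identified with the complex numbers, \<open>F\<close> acts as \<open>x \<mapsto> z x + w cnj x\<close> for unique
  complex numbers \<open>z\<close> and \<open>w\<close>, its Wirtinger derivatives.  They make the two-sided action of
  conformal matrices diagonal.
\<close>

definition holo :: "real^2^2 \<Rightarrow> complex" where
  "holo F = Complex ((F$1$1 + F$2$2) / 2) ((F$2$1 - F$1$2) / 2)"

definition antiholo :: "real^2^2 \<Rightarrow> complex" where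
  "antiholo F = Complex ((F$1$1 - F$2$2) / 2) ((F$2$1 + F$1$2) / 2)"

text \<open>The largest singular value; the other one is the absolute difference of the two moduli.\<close>

definition sigma_max :: "real^2^2 \<Rightarrow> real" where
  "sigma_max F = cmod (holo F) + cmod (antiholo F)"

lemma det_holo_antiholo: "det F = (cmod (holo F))\<^sup>2 - (cmod (antiholo F))\<^sup>2"
  unfolding cmod_power2 holo_def antiholo_def det_2
  by (simp add: power2_eq_square field_simps)

lemma matrix_eqI_holo:
  assumes "holo F = holo G" "antiholo F = antiholo G"
  shows "F = G"
proof -
  have "F$1$1 + F$2$2 = G$1$1 + G$2$2" "F$2$1 - F$1$2 = G$2$1 - G$1$2"
    "F$1$1 - F$2$2 = G$1$1 - G$2$2" "F$2$1 + F$1$2 = G$2$1 + G$1$2"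
    using assms by (simp_all add: holo_def antiholo_def)
  then have "F$1$1 = G$1$1" "F$1$2 = G$1$2" "F$2$1 = G$2$1" "F$2$2 = G$2$2"
    by linarith+
  then show ?thesis by (simp add: vec_eq_iff forall_2)
qed

lemma holo_conf_mult:
  "holo (conf \<alpha> ** F ** conf \<beta>) = \<alpha> * holo F * \<beta>"
  "antiholo (conf \<alpha> ** F ** conf \<beta>) = \<alpha> * antiholo F * cnj \<beta>"
  by (simp_all add: holo_def antiholo_def conf_def matrix_matrix_mult_def sum_2
      complex_eq_iff field_simps)

lemma holo_stretch: "holo (stretch t) = of_real ((t + 1) / 2)"
  "antiholo (stretch t) = of_real ((t - 1) / 2)"
  by (simp_all add: holo_def antiholo_def stretch_def complex_eq_iff)

lemma conf_CSO:
  assumes "c \<noteq> 0" shows "conf c \<in> CSO"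
proof -
  define R where "R = conf (c / of_real (cmod c))"
  have *: "(Re c / cmod c)\<^sup>2 + (Im c / cmod c)\<^sup>2 = 1"
    using assms by (simp add: power_divide add_divide_distrib[symmetric] cmod_power2[symmetric])
  have "rotation_matrix R"
    using * unfolding rotation_matrix_def orthogonal_matrix
    by (simp add: R_def conf_def det_2 matrix_matrix_mult_def transpose_def mat_def vec_eq_iff
        forall_2 sum_2 power2_eq_square algebra_simps)
  moreover have "conf c = cmod c *\<^sub>R R"
    using assms by (simp add: R_def conf_def vec_eq_iff forall_2)
  ultimately show ?thesis using assms unfolding CSO_def by force
qed

lemma stretch_GL_plus: "t > 0 \<Longrightarrow> stretch t \<in> GL_plus"
  by (simp add: GL_plus_def det_2 stretch_def)

text \<open>
  The moduli of the Wirtinger derivatives \<open>z\<close>, \<open>w\<close> of \<open>F\<close> and of the stretch agree up to a common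
  factor, so only the phases have to be adjusted.  The action is \<open>z \<mapsto> \<alpha> z \<beta>\<close>, \<open>w \<mapsto> \<alpha> w cnj \<beta>\<close>; for
  \<open>\<beta>\<close> of modulus one the relative phase of \<open>z\<close> and \<open>w\<close> is multiplied by \<open>\<beta>\<^sup>2\<close>, which is why \<open>\<beta>\<close> is a
  square root, and \<open>\<alpha>\<close> then takes care of \<open>z\<close>.
\<close>

lemma conformal_normal_form:
  assumes "F \<in> GL_plus"
  shows "\<exists>\<alpha> \<beta>. \<alpha> \<noteq> 0 \<and> \<beta> \<noteq> 0 \<and> F = conf \<alpha> ** stretch ((sigma_max F)\<^sup>2 / det F) ** conf \<beta>"
    and "(sigma_max F)\<^sup>2 / det F \<ge> 1"
proof -
  define z w where "z = holo F" and "w = antiholo F"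
  have d: "det F = (cmod z + cmod w) * (cmod z - cmod w)"
    unfolding det_holo_antiholo z_def w_def by (simp add: power2_eq_square algebra_simps)
  have "(cmod w)\<^sup>2 < (cmod z)\<^sup>2"
    using assms by (simp add: GL_plus_def det_holo_antiholo z_def w_def)
  then have lt: "cmod w < cmod z" by (simp add: power_less_imp_less_base)
  then have z: "z \<noteq> 0" by auto
  define t where "t = (sigma_max F)\<^sup>2 / det F"
  have pos: "cmod z + cmod w > 0" using z by (simp add: add_pos_nonneg)
  have t: "t = (cmod z + cmod w) / (cmod z - cmod w)"
    using pos unfolding t_def d sigma_max_def z_def[symmetric] w_def[symmetric]
    by (simp add: power2_eq_square)
  then show "(sigma_max F)\<^sup>2 / det F \<ge> 1"
    using lt unfolding t_def[symmetric] by (simp add: le_divide_eq)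
  have t1: "(t + 1) / 2 = cmod z / (cmod z - cmod w)" "(t - 1) / 2 = cmod w / (cmod z - cmod w)"
    unfolding t using lt by (simp_all add: field_simps)
  \<comment> \<open>The relative phase of \<open>z\<close> and \<open>w\<close>; it is arbitrary if \<open>F\<close> is itself conformal.\<close>
  define b where "b = (if w = 0 then 1 else z * cmod w / (w * cmod z))"
  define \<beta> where "\<beta> = csqrt b"
  have nb: "cmod b = 1" using z by (auto simp: b_def norm_mult norm_divide)
  have \<beta>2: "\<beta> * \<beta> = b" by (simp add: \<beta>_def flip: power2_eq_square)
  have n\<beta>: "cmod \<beta> = 1"
    using nb unfolding \<beta>2[symmetric] norm_mult
    by (metis norm_ge_zero power2_eq_square power2_eq_1_iff norm_not_less_zero zero_less_one
        neg_less_0_iff_less)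
  then have \<beta>: "\<beta> \<noteq> 0" by auto
  have cnj: "cnj \<beta> = 1 / \<beta>"
    using n\<beta> by (simp add: complex_div_cnj[of 1 \<beta>])
  define \<alpha> where "\<alpha> = z * (cmod z - cmod w) / (cmod z * \<beta>)"
  have dne: "complex_of_real (cmod z) - complex_of_real (cmod w) \<noteq> 0"
    using lt by (simp flip: of_real_diff)
  have \<alpha>: "\<alpha> \<noteq> 0" using z \<beta> lt dne by (simp add: \<alpha>_def)
  have "F = conf \<alpha> ** stretch t ** conf \<beta>"
  proof (rule matrix_eqI_holo)
    show "holo F = holo (conf \<alpha> ** stretch t ** conf \<beta>)"
      unfolding holo_conf_mult holo_stretch t1 z_def[symmetric] \<alpha>_def
      using z \<beta> dne by simp
    have "\<alpha> * of_real ((t - 1) / 2) * cnj \<beta> = z * cmod w / (cmod z * b)"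
      unfolding cnj t1 \<alpha>_def \<beta>2[symmetric] using dne \<beta> z by simp
    also have "\<dots> = w" using z by (simp add: b_def)
    finally show "antiholo F = antiholo (conf \<alpha> ** stretch t ** conf \<beta>)"
      unfolding holo_conf_mult holo_stretch w_def by simp
  qed
  then show "\<exists>\<alpha> \<beta>. \<alpha> \<noteq> 0 \<and> \<beta> \<noteq> 0 \<and> F = conf \<alpha> ** stretch ((sigma_max F)\<^sup>2 / det F) ** conf \<beta>"
    using \<alpha> \<beta> unfolding t_def by blast
qed

lemma conformally_invariant_stretch:
  assumes "conformally_invariant W" "F \<in> GL_plus"
  shows "W F = W (stretch ((sigma_max F)\<^sup>2 / det F))"
proof -
  obtain \<alpha> \<beta> where "\<alpha> \<noteq> 0" "\<beta> \<noteq> 0"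
    and F: "F = conf \<alpha> ** stretch ((sigma_max F)\<^sup>2 / det F) ** conf \<beta>"
    using conformal_normal_form(1)[OF assms(2)] by blast
  then have "conf \<alpha> \<in> CSO" "conf \<beta> \<in> CSO" by (simp_all add: conf_CSO)
  moreover have "stretch ((sigma_max F)\<^sup>2 / det F) \<in> GL_plus"
    using conformal_normal_form(2)[OF assms(2)] by (intro stretch_GL_plus) linarith
  ultimately show ?thesis
    using assms(1) F unfolding conformally_invariant_def by metis
qed

lemma conformally_invariant_inverse_stretch:
  assumes "conformally_invariant W" "t > 0"
  shows "W (stretch (1 / t)) = W (stretch t)"
proof -
  have "stretch (1 / t) = conf \<i> ** stretch t ** conf (- \<i> / t)"
    using assms(2)
    by (simp add: stretch_def conf_def matrix_matrix_mult_def sum_2 vec_eq_iff forall_2)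
  moreover have "conf \<i> \<in> CSO" "conf (- \<i> / t) \<in> CSO"
    using assms(2) by (auto intro!: conf_CSO)
  ultimately show ?thesis
    using assms stretch_GL_plus unfolding conformally_invariant_def by metis
qed

section \<open>Convexity of the energy along stretches implies polyconvexity\<close>

lemma sigma_max_convex:
  assumes "0 \<le> t" "t \<le> 1"
  shows "sigma_max ((1 - t) *\<^sub>R F + t *\<^sub>R G) \<le> (1 - t) * sigma_max F + t * sigma_max G"
proof -
  have "holo ((1 - t) *\<^sub>R F + t *\<^sub>R G) = (1 - t) *\<^sub>R holo F + t *\<^sub>R holo G"
    "antiholo ((1 - t) *\<^sub>R F + t *\<^sub>R G) = (1 - t) *\<^sub>R antiholo F + t *\<^sub>R antiholo G"
    by (simp_all add: holo_def antiholo_def complex_eq_iff field_simps)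
  moreover have "cmod ((1 - t) *\<^sub>R x + t *\<^sub>R y) \<le> (1 - t) * cmod x + t * cmod y" for x y
    using norm_triangle_ineq[of "(1 - t) *\<^sub>R x" "t *\<^sub>R y"] assms by simp
  ultimately show ?thesis
    unfolding sigma_max_def by (smt (verit, best) distrib_left)
qed

text \<open>
  The function \<open>(a, c) \<mapsto> a\<^sup>2 / c\<close> is the perspective of the square, hence jointly convex; explicitly,
  the gap in the inequality is a multiple of \<open>(a d - b c)\<^sup>2\<close>.
\<close>

lemma square_over_linear_convex:
  fixes a b c d s t :: real
  assumes "c > 0" "d > 0" "s \<ge> 0" "t \<ge> 0" "s + t > 0"
  shows "(s * a + t * b)\<^sup>2 / (s * c + t * d) \<le> s * (a\<^sup>2 / c) + t * (b\<^sup>2 / d)"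
proof -
  have pos: "s * c + t * d > 0"
    using assms by (cases "s = 0") (auto intro!: add_pos_nonneg)
  have "(s * (a\<^sup>2 / c) + t * (b\<^sup>2 / d)) * (s * c + t * d) - (s * a + t * b)\<^sup>2
      = s * t * (a * d - b * c)\<^sup>2 / (c * d)"
    using assms(1,2) by (simp add: field_simps power2_eq_square)
  moreover have "\<dots> \<ge> 0" using assms by simp
  ultimately show ?thesis using pos by (simp add: divide_le_eq)
qed

text \<open>
  The ratio \<open>\<sigma>(F)\<^sup>2 / d\<close> may lie below 1 when \<open>d\<close> is not the determinant of \<open>F\<close>; there \<open>h\<close> need not
  be nondecreasing, so the energy is extended by its value at 1.
\<close>

lemma polyconvex_if_stretch_convex:
  assumes ci: "conformally_invariant W"
    and conv: "convex_on {0<..} (\<lambda>t. W (stretch t))"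
  shows "polyconvex W"
proof -
  define h where "h t = W (stretch t)" for t
  have h: "convex_on {0<..} h" using conv by (simp add: h_def[abs_def])
  have hc: "h ((1 - u) * x + u * y) \<le> (1 - u) * h x + u * h y"
    if "0 \<le> u" "u \<le> 1" "0 < x" "0 < y" for u x y
    using convex_onD[OF h that(1,2), of x y] that(3,4) by simp
  \<comment> \<open>The point \<open>s\<close> lies between \<open>1/t\<close> and \<open>t\<close>, where \<open>h\<close> takes the same value.\<close>
  have mono: "h s \<le> h t" if "1 \<le> s" "s \<le> t" for s t
  proof (cases "t = 1")
    case False
    with that have t: "t > 1" "1 / t < 1" by auto
    define u where "u = (s - 1 / t) / (t - 1 / t)"
    have *: "0 \<le> s - 1 / t" "s - 1 / t \<le> t - 1 / t" "0 < t - 1 / t" using t that by linarith+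
    have "0 \<le> u" "u \<le> 1"
      unfolding u_def divide_le_eq_1_pos[OF *(3)] using * by (simp_all only: divide_nonneg_pos)
    moreover have "s = (1 - u) * (1 / t) + u * t"
    proof -
      have "u * (t - 1 / t) = s - 1 / t"
        using *(3) u_def by (metis less_irrefl nonzero_eq_divide_eq)
      then show ?thesis unfolding left_diff_distrib right_diff_distrib by linarith
    qed
    ultimately have "h s \<le> (1 - u) * h (1 / t) + u * h t"
      using hc[of u "1 / t" t] t by simp
    also have "h (1 / t) = h t"
      using conformally_invariant_inverse_stretch[OF ci] t by (simp add: h_def)
    finally show ?thesis by (simp add: algebra_simps)
  qed (use that in auto)
  define P :: "(real^2^2) \<times> real \<Rightarrow> ereal" where
    "P = (\<lambda>(F, d). if d > 0 then ereal (h (max 1 ((sigma_max F)\<^sup>2 / d))) else \<infinity>)"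
  have real_case: "h (max 1 ((sigma_max ((1 - t) *\<^sub>R F + t *\<^sub>R G))\<^sup>2 / ((1 - t) * c + t * d)))
      \<le> (1 - t) * h (max 1 ((sigma_max F)\<^sup>2 / c)) + t * h (max 1 ((sigma_max G)\<^sup>2 / d))"
    if t: "0 \<le> t" "t \<le> 1" and cd: "0 < c" "0 < d" for t c d F G
  proof -
    let ?x = "max 1 ((sigma_max F)\<^sup>2 / c)" and ?y = "max 1 ((sigma_max G)\<^sup>2 / d)"
    have nn: "0 \<le> sigma_max H" for H by (simp add: sigma_max_def)
    have pos: "0 < (1 - t) * c + t * d"
      using t cd by (cases "t = 0") (auto intro!: add_nonneg_pos)
    have "(sigma_max ((1 - t) *\<^sub>R F + t *\<^sub>R G))\<^sup>2 / ((1 - t) * c + t * d)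
        \<le> ((1 - t) * sigma_max F + t * sigma_max G)\<^sup>2 / ((1 - t) * c + t * d)"
      using sigma_max_convex[OF t] nn pos by (intro divide_right_mono power_mono) auto
    also have "\<dots> \<le> (1 - t) * ((sigma_max F)\<^sup>2 / c) + t * ((sigma_max G)\<^sup>2 / d)"
      using t cd by (intro square_over_linear_convex) auto
    also have "\<dots> \<le> (1 - t) * ?x + t * ?y"
      using t by (intro add_mono mult_left_mono) auto
    finally have "(sigma_max ((1 - t) *\<^sub>R F + t *\<^sub>R G))\<^sup>2 / ((1 - t) * c + t * d)
        \<le> (1 - t) * ?x + t * ?y" .
    moreover have "1 \<le> (1 - t) * ?x + t * ?y"
      using t add_mono[OF mult_left_mono[of 1 ?x "1 - t"] mult_left_mono[of 1 ?y t]] by simp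
    ultimately have "h (max 1 ((sigma_max ((1 - t) *\<^sub>R F + t *\<^sub>R G))\<^sup>2 / ((1 - t) * c + t * d)))
        \<le> h ((1 - t) * ?x + t * ?y)"
      by (intro mono) auto
    also have "\<dots> \<le> (1 - t) * h ?x + t * h ?y"
      using t by (intro hc) auto
    finally show ?thesis .
  qed
  have "ereal_convex P"
    unfolding ereal_convex_def
  proof (intro conjI allI ballI)
    fix x show "P x \<noteq> -\<infinity>" by (cases x) (simp add: P_def)
  next
    fix x y :: "(real^2^2) \<times> real" and t :: real
    assume t: "t \<in> {0..1}"
    obtain F c G d where xy: "x = (F, c)" "y = (G, d)" by (cases x, cases y) auto
    consider "t = 0" | "t = 1" | "0 < t" "t < 1" "c \<le> 0 \<or> d \<le> 0" | "0 < c" "0 < d"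
      using t by fastforce
    then show "P ((1 - t) *\<^sub>R x + t *\<^sub>R y) \<le> ereal (1 - t) * P x + ereal t * P y"
    proof cases
      case 3
      then have "ereal (1 - t) * P x + ereal t * P y = \<infinity>"
        by (auto simp: xy P_def)
      then show ?thesis by (simp only: ereal_less_eq)
    next
      case 4
      have "0 < (1 - t) * c + t * d"
        using t 4 by (cases "t = 0") (auto intro!: add_nonneg_pos)
      then show ?thesis using 4 t real_case[of t c d F G] by (simp add: xy P_def)
    qed (simp_all flip: zero_ereal_def one_ereal_def)
  qed
  moreover have "ereal (W F) = P (F, det F)" if "F \<in> GL_plus" for F
    using conformally_invariant_stretch[OF ci that] conformal_normal_form(2)[OF that] that
    by (simp add: P_def h_def max_def GL_plus_def)
  ultimately show ?thesis unfolding polyconvex_def by blast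
qed

section \<open>A stretch with a kink as a competitor\<close>

text \<open>
  Integration by parts for a function of one coordinate passes to pointwise limits of
  continuously differentiable functions, by dominated convergence.  The derivatives may fail to
  converge at one value \<open>\<theta>\<close>, since the corresponding hyperplane is a null set.
\<close>

lemma weak_partial_deriv_limit:
  fixes \<eta> :: "real^'n \<Rightarrow> real" and v v' :: "nat \<Rightarrow> real \<Rightarrow> real" and u u' :: "real \<Rightarrow> real"
  assumes t: "test_function U \<eta>"
    and d: "\<And>n r. (v n has_real_derivative v' n r) (at r)"
    and cv': "\<And>n. continuous_on UNIV (v' n)"
    and bv: "\<And>n r. \<bar>v n r\<bar> \<le> C * (1 + \<bar>r\<bar>)" and bv': "\<And>n r. \<bar>v' n r\<bar> \<le> C"
    and lim: "\<And>r. (\<lambda>n. v n r) \<longlonglongrightarrow> u r"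
    and lim': "\<And>r. r \<noteq> \<theta> \<Longrightarrow> (\<lambda>n. v' n r) \<longlonglongrightarrow> u' r"
    and m: "u' \<in> borel_measurable borel" and bu': "\<And>r. \<bar>u' r\<bar> \<le> C"
  shows "(LINT x:U|lebesgue. u (x $ k) * partial_deriv j \<eta> x) =
         - (LINT x:U|lebesgue. (if j = k then u' (x $ k) else 0) * \<eta> x)"
proof -
  let ?D = "partial_deriv j \<eta>"
  have "C_k (Suc 0) \<eta>" "C_k 0 \<eta>" using t unfolding test_function_def by blast+
  then have ce: "continuous_on UNIV \<eta>" and cD: "continuous_on UNIV ?D" by auto
  define S where "S = closure {x. \<eta> x \<noteq> 0}"
  have S: "compact S" "S \<subseteq> U" using t by (auto simp: test_function_def S_def)
  have z: "\<eta> x = 0" if "x \<notin> S" for x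
    using that closure_subset[of "{x. \<eta> x \<noteq> 0}"] unfolding S_def by blast
  have zD: "?D x = 0" if "x \<notin> S" for x
  proof -
    have "open (- S)" using S(1) by (simp add: compact_imp_closed open_Compl)
    then have "(\<eta> has_derivative (\<lambda>_. 0)) (at x)"
      using has_derivative_transform_within_open[OF has_derivative_const, of "- S" x 0 \<eta>] z that
      by force
    then show ?thesis by (simp add: partial_deriv_def frechet_derivative_at[symmetric])
  qed
  obtain R where R: "\<And>x. x \<in> S \<Longrightarrow> norm x \<le> R"
    using compact_imp_bounded[OF S(1)] by (auto simp: bounded_iff)
  have "compact ((\<lambda>x. (\<eta> x, ?D x)) ` S)"
    by (intro compact_continuous_image S(1) continuous_on_Pair continuous_on_subset[OF ce]
        continuous_on_subset[OF cD]) auto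
  then obtain B where B: "\<And>x. x \<in> S \<Longrightarrow> norm (\<eta> x, ?D x) \<le> B"
    by (force dest!: compact_imp_bounded simp: bounded_iff)
  have Be: "\<bar>\<eta> x\<bar> \<le> B" and BD: "\<bar>?D x\<bar> \<le> B" if "x \<in> S" for x
    using B[OF that] norm_fst_le[of "\<eta> x" "?D x"] norm_snd_le[of "?D x" "\<eta> x"] by auto
  have C0: "C \<ge> 0" using bv'[of 0 0] by linarith
  have bu: "\<bar>u r\<bar> \<le> C * (1 + \<bar>r\<bar>)" for r
    using lim[of r] bv by (intro LIMSEQ_le_const2[OF tendsto_rabs]) auto
  define M where "M = C * (1 + R) * B"
  \<comment> \<open>On the support of \<open>\<eta>\<close> the growth bound \<open>C * (1 + \<bar>r\<bar>)\<close> is at most \<open>C * (1 + R)\<close>, so one constant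
    dominates all the integrands.\<close>
  have major1: "\<bar>g (x $ k) * ?D x\<bar> \<le> M * indicator S x"
    if "\<And>r. \<bar>g r\<bar> \<le> C * (1 + \<bar>r\<bar>)" for g x
  proof (cases "x \<in> S")
    case True
    have "\<bar>x $ k\<bar> \<le> R" using R[OF True] component_le_norm_cart[of x k] by linarith
    then have "\<bar>g (x $ k)\<bar> \<le> C * (1 + R)"
      using that[of "x $ k"] C0 by (smt (verit) mult_left_mono)
    then show ?thesis using BD[OF True] True
      by (simp add: abs_mult M_def mult_mono')
  qed (simp add: zD)
  have major2: "\<bar>g (x $ k) * \<eta> x\<bar> \<le> M * indicator S x"
    if "\<And>r. \<bar>g r\<bar> \<le> C" for g x
  proof (cases "x \<in> S")
    case True
    have "0 \<le> R" using R[OF True] norm_ge_zero[of x] by linarith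
    then have "\<bar>g (x $ k)\<bar> \<le> C * (1 + R)"
      using that[of "x $ k"] C0 by (simp add: distrib_left add_increasing2)
    then show ?thesis using Be[OF True] True
      by (simp add: abs_mult M_def mult_mono')
  qed (simp add: z)
  have iM: "integrable lborel (\<lambda>x. M * indicator S x)"
    using S(1) by (intro integrable_mult_right integrable_real_indicator emeasure_bounded_finite)
      (auto intro: compact_imp_bounded borel_compact)
  have vc: "continuous_on UNIV (v n)" for n
    using d by (auto intro: DERIV_continuous_on has_field_derivative_at_within)
  have mu: "u \<in> borel_measurable borel"
    by (rule borel_measurable_LIMSEQ_real[OF lim])
      (simp add: vc borel_measurable_continuous_onI)
  have me: "\<eta> \<in> borel_measurable borel" "?D \<in> borel_measurable borel"
    using ce cD by (auto intro: borel_measurable_continuous_onI)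
  have mk: "(\<lambda>x::real^'n. x $ k) \<in> borel_measurable borel"
    by (intro borel_measurable_continuous_onI continuous_intros)
  have mv': "v' n \<in> borel_measurable borel" "v n \<in> borel_measurable borel" for n
    using cv' vc by (auto intro: borel_measurable_continuous_onI)
  have meas: "(\<lambda>x. g (x $ k) * ?D x) \<in> borel_measurable lborel"
    "(\<lambda>x. g (x $ k) * \<eta> x) \<in> borel_measurable lborel" if "g \<in> borel_measurable borel" for g
    using measurable_compose[OF mk that] me by auto
  have int1: "integrable lborel (\<lambda>x. g (x $ k) * ?D x)"
    if "g \<in> borel_measurable borel" "\<And>r. \<bar>g r\<bar> \<le> C * (1 + \<bar>r\<bar>)" for g
    by (rule Bochner_Integration.integrable_bound[OF iM meas(1)[OF that(1)]])
      (use major1[OF that(2)] in \<open>auto intro: order_trans[OF _ abs_ge_self]\<close>)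
  have int2: "integrable lborel (\<lambda>x. g (x $ k) * \<eta> x)"
    if "g \<in> borel_measurable borel" "\<And>r. \<bar>g r\<bar> \<le> C" for g
    by (rule Bochner_Integration.integrable_bound[OF iM meas(2)[OF that(1)]])
      (use major2[where g = g, OF that(2)] in \<open>auto intro: order_trans[OF _ abs_ge_self]\<close>)
  define \<delta> :: real where "\<delta> = (if j = k then 1 else 0)"
  have parts: "(LINT x|lborel. v n (x $ k) * ?D x) = - \<delta> * (LINT x|lborel. v' n (x $ k) * \<eta> x)" for n
  proof -
    let ?h = "\<lambda>x. v n (x $ k) * \<eta> x"
    let ?h' = "\<lambda>x. v n (x $ k) * ?D x + \<delta> * (v' n (x $ k) * \<eta> x)"
    have "integral\<^sup>L lborel ?h' = 0"
    proof (rule integral_dir_deriv_zero[where g = ?h and v = "axis j 1" and R = R])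
      show "((\<lambda>t. ?h (x + t *\<^sub>R axis j 1)) has_real_derivative ?h' (x + t *\<^sub>R axis j 1)) (at t)"
        for x t
      proof -
        have "((\<lambda>t. (x + t *\<^sub>R axis j 1) $ k) has_real_derivative \<delta>) (at t)"
          by (auto simp: \<delta>_def axis_def intro!: derivative_eq_intros)
        from DERIV_mult[OF DERIV_chain2[OF d this] test_function_line_deriv[OF t]]
        show ?thesis by (simp add: algebra_simps)
      qed
      have *: "continuous_on UNIV (\<lambda>x::real^'n. v n (x $ k))"
        by (intro continuous_on_compose2[OF vc] continuous_intros) auto
      have **: "continuous_on UNIV (\<lambda>x::real^'n. v' n (x $ k))"
        by (intro continuous_on_compose2[OF cv'] continuous_intros) auto
      show "continuous_on UNIV ?h" "continuous_on UNIV ?h'"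
        by (intro continuous_intros ce cD * **)+
      show "?h x = 0" "?h' x = 0" if "norm x > R" for x using that z[of x] zD[of x] R[of x] by force+
    qed
    then show ?thesis
      using int1[OF mv'(2) bv] int2[OF mv'(1) bv'] by simp
  qed
  have "(\<lambda>n. LINT x|lborel. v n (x $ k) * ?D x) \<longlonglongrightarrow> (LINT x|lborel. u (x $ k) * ?D x)"
  proof (rule integral_dominated_convergence[OF meas(1)[OF mu] meas(1)[OF mv'(2)] iM])
    show "AE x in lborel. (\<lambda>n. v n (x $ k) * ?D x) \<longlonglongrightarrow> u (x $ k) * ?D x"
      by (auto intro!: tendsto_intros lim)
    show "AE x in lborel. norm (v n (x $ k) * ?D x) \<le> M * indicator S x" for n
      using major1[where g = "v n", OF bv] by simp
  qed
  moreover have "(\<lambda>n. LINT x|lborel. v' n (x $ k) * \<eta> x) \<longlonglongrightarrow> (LINT x|lborel. u' (x $ k) * \<eta> x)"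
  proof (rule integral_dominated_convergence[OF meas(2)[OF m] meas(2)[OF mv'(1)] iM])
    have "negligible {x::real^'n. x $ k = \<theta>}" 
      using negligible_standard_hyperplane[of "axis k 1 :: real^'n" \<theta>]
      by (simp add: inner_axis axis_in_Basis_iff)
    then have "AE x in lebesgue. x \<notin> {x::real^'n. x $ k = \<theta>}"
      unfolding negligible_iff_null_sets by (rule AE_not_in)
    then have "AE x in lborel. x \<notin> {x::real^'n. x $ k = \<theta>}"
      by (simp add: AE_completion_iff)
    then show "AE x in lborel. (\<lambda>n. v' n (x $ k) * \<eta> x) \<longlonglongrightarrow> u' (x $ k) * \<eta> x"
      by eventually_elim (auto intro!: tendsto_intros lim')
    show "AE x in lborel. norm (v' n (x $ k) * \<eta> x) \<le> M * indicator S x" for n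
      using major2[where g = "v' n", OF bv'] by simp
  qed
  then have "(\<lambda>n. - \<delta> * (LINT x|lborel. v' n (x $ k) * \<eta> x)) \<longlonglongrightarrow>
      - \<delta> * (LINT x|lborel. u' (x $ k) * \<eta> x)" by (intro tendsto_intros)
  ultimately have *: "(LINT x|lborel. u (x $ k) * ?D x) = - \<delta> * (LINT x|lborel. u' (x $ k) * \<eta> x)"
    unfolding parts by (rule LIMSEQ_unique)
  have "(LINT x:U|lebesgue. u (x $ k) * ?D x) = (LINT x|lebesgue. u (x $ k) * ?D x)"
    unfolding set_lebesgue_integral_def using S(2) zD
    by (intro Bochner_Integration.integral_cong) (auto simp: indicator_def)
  moreover have "(LINT x:U|lebesgue. (if j = k then u' (x $ k) else 0) * \<eta> x)
      = \<delta> * (LINT x|lebesgue. u' (x $ k) * \<eta> x)"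
    unfolding set_lebesgue_integral_def integral_mult_right_zero[symmetric] using S(2) z
    by (intro Bochner_Integration.integral_cong) (auto simp: indicator_def \<delta>_def)
  ultimately show ?thesis
    using * integral_completion[OF meas(1)[OF mu]] integral_completion[OF meas(2)[OF m]] by simp
qed

definition kink :: "real \<Rightarrow> real \<Rightarrow> real \<Rightarrow> real \<Rightarrow> real" where
  "kink \<theta> s t r = s * r + (t - s) * max 0 (r - \<theta>)"

text \<open>
  The positive part of \<open>r - \<theta>\<close> is the limit of the smooth functions
  \<open>(r - \<theta> + sqrt((r - \<theta>)\<^sup>2 + \<epsilon>)) / 2\<close>, whose derivatives lie between 0 and 1.
\<close>

lemma weak_partial_deriv_kink:
  fixes \<eta> :: "real^'n \<Rightarrow> real"
  assumes "test_function U \<eta>"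
  shows "(LINT x:U|lebesgue. kink \<theta> s t (x $ k) * partial_deriv j \<eta> x) =
         - (LINT x:U|lebesgue. (if j = k then if x $ k \<le> \<theta> then s else t else 0) * \<eta> x)"
proof -
  define e where "e n = 1 / real (Suc n)" for n
  have e: "0 < e n" "e n \<le> 1" for n by (auto simp: e_def)
  have e0: "e \<longlonglongrightarrow> 0"
    using LIMSEQ_inverse_real_of_nat by (simp add: e_def[abs_def] inverse_eq_divide)
  define q where "q n r = sqrt ((r - \<theta>)\<^sup>2 + e n)" for n r
  have arg: "0 < (r - \<theta>)\<^sup>2 + e n" for n r using e(1)[of n] by (simp add: add_nonneg_pos)
  have q: "0 < q n r" "\<bar>r - \<theta>\<bar> \<le> q n r" "q n r \<le> \<bar>r - \<theta>\<bar> + 1" for n r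
  proof -
    show "0 < q n r" using arg by (simp add: q_def)
    have "sqrt ((r - \<theta>)\<^sup>2) \<le> q n r"
      unfolding q_def using e(1)[of n] by (intro real_sqrt_le_mono) simp
    then show "\<bar>r - \<theta>\<bar> \<le> q n r" by simp
    have "e n \<le> 1 + 2 * \<bar>r - \<theta>\<bar>" using e(2)[of n] by (rule order_trans) simp
    then have "(r - \<theta>)\<^sup>2 + e n \<le> (\<bar>r - \<theta>\<bar> + 1)\<^sup>2" by (simp add: power2_sum)
    then have "sqrt ((r - \<theta>)\<^sup>2 + e n) \<le> sqrt ((\<bar>r - \<theta>\<bar> + 1)\<^sup>2)"
      by (rule real_sqrt_le_mono)
    then show "q n r \<le> \<bar>r - \<theta>\<bar> + 1" by (simp add: q_def)
  qed
  have q_lim: "(\<lambda>n. q n r) \<longlonglongrightarrow> \<bar>r - \<theta>\<bar>" for r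
  proof -
    have "(\<lambda>n. q n r) \<longlonglongrightarrow> sqrt ((r - \<theta>)\<^sup>2 + 0)"
      unfolding q_def by (intro tendsto_intros e0)
    then show ?thesis by simp
  qed
  define v where "v n r = s * r + (t - s) * ((r - \<theta> + q n r) / 2)" for n r
  define v' where "v' n r = s + (t - s) * ((1 + (r - \<theta>) / q n r) / 2)" for n r
  define C where "C = \<bar>s\<bar> + \<bar>t\<bar> + \<bar>t - s\<bar> * (1 + \<bar>\<theta>\<bar>)"
  show ?thesis
  proof (rule weak_partial_deriv_limit[OF assms, where v = v and v' = v' and C = C and \<theta> = \<theta>])
    fix n r
    have "((\<lambda>r. q n r) has_real_derivative (r - \<theta>) / q n r) (at r)"
      unfolding q_def using arg[of r n]
      by (auto intro!: derivative_eq_intros simp: field_simps)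
    then show "(v n has_real_derivative v' n r) (at r)"
      unfolding v_def v'_def by (auto intro!: derivative_eq_intros)
    have "\<bar>(r - \<theta> + q n r) / 2\<bar> \<le> (1 + \<bar>\<theta>\<bar>) * (1 + \<bar>r\<bar>)"
    proof -
      have "0 \<le> r - \<theta> + q n r" using q(2)[of r n] by linarith
      then have "\<bar>(r - \<theta> + q n r) / 2\<bar> = (r - \<theta> + q n r) / 2" by simp
      also have "\<dots> \<le> 1 + \<bar>r - \<theta>\<bar>" using q(3)[of n r] abs_ge_self[of "r - \<theta>"]
        by (simp add: divide_le_eq)
      also have "\<dots> \<le> 1 + \<bar>\<theta>\<bar> + \<bar>r\<bar>" by linarith
      also have "\<dots> \<le> (1 + \<bar>\<theta>\<bar>) * (1 + \<bar>r\<bar>)" by (simp add: algebra_simps)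
      finally show ?thesis .
    qed
    then have "\<bar>v n r\<bar> \<le> \<bar>s\<bar> * \<bar>r\<bar> + \<bar>t - s\<bar> * ((1 + \<bar>\<theta>\<bar>) * (1 + \<bar>r\<bar>))"
      unfolding v_def by (intro abs_triangle_ineq[THEN order_trans] add_mono)
        (simp_all only: abs_mult mult_left_mono abs_ge_zero order_refl)
    also have "\<dots> \<le> C * (1 + \<bar>r\<bar>)"
      unfolding C_def by (simp add: algebra_simps)
    finally show "\<bar>v n r\<bar> \<le> C * (1 + \<bar>r\<bar>)" .
    have "\<bar>(r - \<theta>) / q n r\<bar> \<le> 1" using q[where n = n and r = r] by (simp add: abs_divide)
    then have "\<bar>1 + (r - \<theta>) / q n r\<bar> \<le> 2" unfolding abs_le_iff by linarith
    then have "\<bar>(1 + (r - \<theta>) / q n r) / 2\<bar> \<le> 1" by simp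
    then have "\<bar>(1 + (r - \<theta>) / q n r) / 2\<bar> \<le> 1 + \<bar>\<theta>\<bar>" by (rule order_trans) simp
    then have "\<bar>v' n r\<bar> \<le> \<bar>s\<bar> + \<bar>t - s\<bar> * (1 + \<bar>\<theta>\<bar>)"
      unfolding v'_def by (intro abs_triangle_ineq[THEN order_trans] add_mono)
        (simp_all only: abs_mult mult_left_mono abs_ge_zero order_refl)
    then show "\<bar>v' n r\<bar> \<le> C" by (simp add: C_def)
  next
    fix n show "continuous_on UNIV (v' n)"
      unfolding v'_def q_def using arg[of _ n]
      by (intro continuous_intros) (auto simp: less_le)
  next
    fix r
    have "(\<lambda>n. v n r) \<longlonglongrightarrow> s * r + (t - s) * ((r - \<theta> + \<bar>r - \<theta>\<bar>) / 2)"
      unfolding v_def by (intro tendsto_intros q_lim) auto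
    also have "(r - \<theta> + \<bar>r - \<theta>\<bar>) / 2 = max 0 (r - \<theta>)" by (simp add: max_def)
    finally show "(\<lambda>n. v n r) \<longlonglongrightarrow> kink \<theta> s t r" by (simp add: kink_def)
  next
    fix r assume r: "r \<noteq> \<theta>"
    have "(\<lambda>n. v' n r) \<longlonglongrightarrow> s + (t - s) * ((1 + (r - \<theta>) / \<bar>r - \<theta>\<bar>) / 2)"
      unfolding v'_def using r by (intro tendsto_intros q_lim) auto
    also have "s + (t - s) * ((1 + (r - \<theta>) / \<bar>r - \<theta>\<bar>) / 2) = (if r \<le> \<theta> then s else t)"
    proof -
      have "(r - \<theta>) / \<bar>r - \<theta>\<bar> = (if r \<le> \<theta> then -1 else 1)"
        using r by (auto simp: abs_if divide_eq_minus_1_iff)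
      then show ?thesis by (auto simp: field_simps)
    qed
    finally show "(\<lambda>n. v' n r) \<longlonglongrightarrow> (if r \<le> \<theta> then s else t)" .
  next
    show "(\<lambda>r. if r \<le> \<theta> then s else t) \<in> borel_measurable borel" by measurable
    fix r show "\<bar>if r \<le> \<theta> then s else t\<bar> \<le> C" by (auto simp: C_def add_increasing2)
  qed
qed

definition kink_map :: "real \<Rightarrow> real \<Rightarrow> real \<Rightarrow> real^2 \<Rightarrow> real^2" where
  "kink_map \<theta> s t x = vector [kink \<theta> s t (x $ 1), x $ 2]"

definition kink_grad :: "real \<Rightarrow> real \<Rightarrow> real \<Rightarrow> real^2 \<Rightarrow> real^2^2" where
  "kink_grad \<theta> s t x = stretch (if x $ 1 \<le> \<theta> then s else t)"

lemma continuous_kink_map: "continuous_on UNIV (kink_map \<theta> s t)"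
proof -
  have "kink_map \<theta> s t = (\<lambda>x. \<chi> i. if i = 1 then kink \<theta> s t (x $ 1) else x $ 2)"
    by (auto simp: fun_eq_iff kink_map_def vec_eq_iff forall_2)
  moreover have "continuous_on UNIV (\<lambda>x::real^2. if i = 1 then kink \<theta> s t (x $ 1) else x $ 2)"
    for i :: 2
    unfolding kink_def by (cases "i = 1") (auto intro!: continuous_intros)
  ultimately show ?thesis by (simp add: continuous_on_vec_lambda)
qed

lemma weak_gradient_kink_map:
  "weak_gradient U (kink_map \<theta> s t) (kink_grad \<theta> s t)"
  unfolding weak_gradient_def
proof (intro allI impI)
  fix \<eta> :: "real^2 \<Rightarrow> real" and i j :: 2
  assume t: "test_function U \<eta>"
  \<comment> \<open>The second component is a kink function as well, with both slopes equal to 1.\<close>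
  show "(LINT x:U|lebesgue. kink_map \<theta> s t x $ i * partial_deriv j \<eta> x) =
      - (LINT x:U|lebesgue. kink_grad \<theta> s t x $ i $ j * \<eta> x)"
  proof (cases "i = 1")
    case True
    then have "kink_grad \<theta> s t x $ i $ j = (if j = 1 then if x $ 1 \<le> \<theta> then s else t else 0)" for x
      using exhaust_2[of j] by (auto simp: kink_grad_def stretch_def)
    then show ?thesis
      using weak_partial_deriv_kink[OF t, of \<theta> s t 1 j] True by (simp add: kink_map_def)
  next
    case False
    then have i: "i = 2" using exhaust_2[of i] by simp
    have "kink_grad \<theta> s t x $ i $ j = (if j = 2 then if x $ 2 \<le> 0 then 1 else 1 else 0)" for x
      using exhaust_2[of j] i by (auto simp: kink_grad_def stretch_def)
    moreover have "kink_map \<theta> s t x $ i = kink 0 1 1 (x $ 2)" for x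
      by (simp add: i kink_map_def kink_def)
    ultimately show ?thesis
      using weak_partial_deriv_kink[OF t, of 0 1 1 2 j] by (simp cong: if_cong)
  qed
qed

lemma two_valued_integral:
  fixes f :: "real \<Rightarrow> 'a::{banach, second_countable_topology}" and K :: "(real^2) set"
  assumes K: "K \<in> lmeasurable"
  shows set_integrable_two_valued:
      "set_integrable lebesgue K (\<lambda>x. f (if x $ 1 \<le> \<theta> then s else t))"
    and set_integral_two_valued:
      "(LINT x:K|lebesgue. f (if x $ 1 \<le> \<theta> then s else t)) =
        measure lebesgue (K \<inter> {x. x $ 1 \<le> \<theta>}) *\<^sub>R f s +
        (measure lebesgue K - measure lebesgue (K \<inter> {x. x $ 1 \<le> \<theta>})) *\<^sub>R f t"
proof -
  define H where "H = {x::real^2. x $ 1 \<le> \<theta>}"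
  have "H \<in> sets lebesgue"
    unfolding H_def
    by (intro sets_completionI_sets) (simp add: borel_closed closed_halfspace_component_le_cart)
  then have KH: "K \<inter> H \<in> lmeasurable" "K - H \<in> lmeasurable"
    using K by (auto intro: fmeasurable_Int_fmeasurable fmeasurable_Diff)
  have "measure lebesgue K = measure lebesgue ((K \<inter> H) \<union> (K - H))" by (simp add: Int_Diff_Un)
  also have "\<dots> = measure lebesgue (K \<inter> H) + measure lebesgue (K - H)"
    using KH by (intro measure_Union) (auto simp: fmeasurable_def)
  finally have m: "measure lebesgue (K - H) = measure lebesgue K - measure lebesgue (K \<inter> H)"
    by simp
  have "has_bochner_integral lebesgue
      (\<lambda>x. indicator (K \<inter> H) x *\<^sub>R f s + indicator (K - H) x *\<^sub>R f t)
      (measure lebesgue (K \<inter> H) *\<^sub>R f s + measure lebesgue (K - H) *\<^sub>R f t)"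
    using KH by (intro has_bochner_integral_add has_bochner_integral_scaleR_left
        has_bochner_integral_real_indicator) (auto simp: fmeasurable_def)
  also have "(\<lambda>x. indicator (K \<inter> H) x *\<^sub>R f s + indicator (K - H) x *\<^sub>R f t) =
      (\<lambda>x. indicator K x *\<^sub>R f (if x $ 1 \<le> \<theta> then s else t))"
    by (auto simp: fun_eq_iff indicator_def H_def)
  finally have hb: "has_bochner_integral lebesgue
      (\<lambda>x. indicator K x *\<^sub>R f (if x $ 1 \<le> \<theta> then s else t))
      (measure lebesgue (K \<inter> H) *\<^sub>R f s + measure lebesgue (K - H) *\<^sub>R f t)" .
  show "set_integrable lebesgue K (\<lambda>x. f (if x $ 1 \<le> \<theta> then s else t))"
    unfolding set_integrable_def using hb by (rule integrable.intros)
  show "(LINT x:K|lebesgue. f (if x $ 1 \<le> \<theta> then s else t)) =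
        measure lebesgue (K \<inter> {x. x $ 1 \<le> \<theta>}) *\<^sub>R f s +
        (measure lebesgue K - measure lebesgue (K \<inter> {x. x $ 1 \<le> \<theta>})) *\<^sub>R f t"
    unfolding set_lebesgue_integral_def m[symmetric] H_def[symmetric]
    using has_bochner_integral_integral_eq[OF hb] by (simp add: m)
qed

lemma kink_bounds:
  assumes "0 < s" "0 < t" "0 \<le> \<theta>" "\<theta> \<le> 1"
  shows "kink \<theta> s t 0 = 0" "kink \<theta> s t 1 = \<theta> * s + (1 - \<theta>) * t"
    "0 \<le> r \<Longrightarrow> 0 \<le> kink \<theta> s t r"
    "r \<le> 1 \<Longrightarrow> kink \<theta> s t r \<le> \<theta> * s + (1 - \<theta>) * t"
proof -
  show "kink \<theta> s t 0 = 0" using assms by (simp add: kink_def)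
  show *: "kink \<theta> s t 1 = \<theta> * s + (1 - \<theta>) * t"
    using assms by (simp add: kink_def algebra_simps)
  have k: "kink \<theta> s t r = s * min r \<theta> + t * max 0 (r - \<theta>)" for r
    by (simp add: kink_def min_def max_def algebra_simps)
  show "0 \<le> kink \<theta> s t r" if "0 \<le> r"
    unfolding k using assms that by (intro add_nonneg_nonneg mult_nonneg_nonneg) auto
  show "kink \<theta> s t r \<le> \<theta> * s + (1 - \<theta>) * t" if "r \<le> 1"
    unfolding *[symmetric] k using assms that by (intro add_mono mult_left_mono) auto
qed

lemma admissible_kink_map:
  assumes st: "0 < s" "0 < t" and \<theta>: "0 \<le> \<theta>" "\<theta> \<le> 1" and p: "p > 0"
  shows "admissible p (vector [1, 1]) (vector [\<theta> * s + (1 - \<theta>) * t, 1])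
           (kink_map \<theta> s t) (kink_grad \<theta> s t)"
proof -
  let ?a = "vector [1, 1] :: real^2" and ?a' = "vector [\<theta> * s + (1 - \<theta>) * t, 1] :: real^2"
  note kb = kink_bounds[OF st \<theta>]
  have im: "kink_map \<theta> s t x \<in> cbox 0 ?a'" if "x \<in> cbox 0 ?a" for x
    using that kb(3,4) by (simp add: mem_box_cart forall_2 kink_map_def)
  show ?thesis
    unfolding admissible_def sobolev_loc_def
  proof (intro conjI allI)
    show "Lp_loc p (box 0 ?a) (kink_map \<theta> s t)"
      by (intro Lp_loc_continuous continuous_kink_map open_box p)
    show "Lp_loc p (box 0 ?a) (kink_grad \<theta> s t)"
      unfolding Lp_loc_def
    proof (intro conjI allI impI)
      have "set_integrable lebesgue (box 0 ?a) (kink_grad \<theta> s t)"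
        unfolding kink_grad_def by (intro set_integrable_two_valued) simp
      then show "set_borel_measurable lebesgue (box 0 ?a) (kink_grad \<theta> s t)"
        unfolding set_integrable_def set_borel_measurable_def
        by (rule borel_measurable_integrable)
      fix K assume "compact K \<and> K \<subseteq> box 0 ?a"
      then show "set_integrable lebesgue K (\<lambda>x. norm (kink_grad \<theta> s t x) powr p)"
        using set_integrable_two_valued[of K "\<lambda>r. norm (stretch r) powr p" \<theta> s t]
        by (simp add: kink_grad_def lmeasurable_compact)
    qed
    show "weak_gradient (box 0 ?a) (kink_map \<theta> s t) (kink_grad \<theta> s t)"
      by (rule weak_gradient_kink_map)
    show "continuous_on (cbox 0 ?a) (kink_map \<theta> s t)"
      using continuous_kink_map by (rule continuous_on_subset) simp
    show "kink_map \<theta> s t ` cbox 0 ?a \<subseteq> cbox 0 ?a'" using im by blast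
    show "AE x in lebesgue. x \<in> box 0 ?a \<longrightarrow> det (kink_grad \<theta> s t x) > 0"
      using st by (simp add: kink_grad_def det_2 stretch_def)
    fix i :: 2
    have "kink_map \<theta> s t x $ i = 0" if "x $ i = 0" for x
      using that exhaust_2[of i] kb(1) by (auto simp: kink_map_def)
    then show "kink_map \<theta> s t ` {x \<in> cbox 0 ?a. x $ i = 0} \<subseteq> {y \<in> cbox 0 ?a'. y $ i = 0}"
      using im by blast
    have "kink_map \<theta> s t x $ i = ?a' $ i" if "x $ i = ?a $ i" for x
      using that exhaust_2[of i] kb(2) by (auto simp: kink_map_def)
    then show "kink_map \<theta> s t ` {x \<in> cbox 0 ?a. x $ i = ?a $ i} \<subseteq> {y \<in> cbox 0 ?a'. y $ i = ?a' $ i}"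
      using im by blast
  qed
qed

lemma measure_rectangle:
  assumes "0 \<le> b" "0 \<le> c"
  shows "measure lebesgue (cbox 0 (vector [b, c] :: real^2)) = b * c"
proof -
  have "(0::real^2) \<in> cbox 0 (vector [b, c])"
    using assms by (simp add: mem_box_cart forall_2)
  then have "cbox 0 (vector [b, c] :: real^2) \<noteq> {}" by blast
  then show ?thesis
    by (simp add: measure_completion content_cbox_cart UNIV_2)
qed

text \<open>
  The target rectangle has the width reached by the kinked map, so that the affine map stretches
  by the mean slope.  The convexity inequality is the minimality of the affine map.
\<close>

lemma groetzsch_stretch_convex:
  assumes p: "p > 0" and g: "groetzsch_property p W"
  shows "convex_on {0<..} (\<lambda>t. W (stretch t))"
proof (rule convex_onI)
  fix u s t :: real
  assume u: "0 < u" "u < 1" and st: "s \<in> {0<..}" "t \<in> {0<..}"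
  define \<theta> where "\<theta> = 1 - u"
  have \<theta>: "0 \<le> \<theta>" "\<theta> \<le> 1" using u by (auto simp: \<theta>_def)
  let ?a = "vector [1, 1] :: real^2" and ?m = "\<theta> * s + (1 - \<theta>) * t"
  let ?a' = "vector [?m, 1] :: real^2"
  have pos: "\<forall>i. ?a $ i > 0" "\<forall>i. ?a' $ i > 0"
    using st u by (auto simp: forall_2 \<theta>_def intro!: add_pos_pos)
  have lin: "matrix (affine_stretch ?a ?a') = stretch ?m"
    by (simp add: matrix_def affine_stretch_def stretch_def vec_eq_iff forall_2 axis_def)
  have K: "cbox 0 ?a \<in> lmeasurable" by simp
  have half: "cbox 0 ?a \<inter> {x. x $ 1 \<le> \<theta>} = cbox 0 (vector [\<theta>, 1])"
    using \<theta> by (auto simp: mem_box_cart forall_2)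
  have int: "set_integrable lebesgue (cbox 0 ?a) (\<lambda>x. W (kink_grad \<theta> s t x))"
    unfolding kink_grad_def using set_integrable_two_valued[OF K, of "\<lambda>r. W (stretch r)"] .
  have "W (stretch ?m) = (LINT x:cbox 0 ?a|lebesgue. W (matrix (affine_stretch ?a ?a')))"
    using measure_rectangle[of 1 1] unfolding lin by (simp add: set_lebesgue_integral_def)
  also have "\<dots> \<le> (LINT x:cbox 0 ?a|lebesgue. W (kink_grad \<theta> s t x))"
    using g pos admissible_kink_map[OF _ _ \<theta> p, of s t] st int
    unfolding groetzsch_property_def is_arg_min_def by force
  also have "\<dots> = \<theta> * W (stretch s) + (1 - \<theta>) * W (stretch t)"
    unfolding kink_grad_def set_integral_two_valued[OF K, of "\<lambda>r. W (stretch r)"] half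
    using \<theta> measure_rectangle[of 1 1] measure_rectangle[of \<theta> 1] by simp
  finally show "W (stretch ((1 - u) *\<^sub>R s + u *\<^sub>R t)) \<le> (1 - u) * W (stretch s) + u * W (stretch t)"
    by (simp add: \<theta>_def)
qed simp

section \<open>The Groetzsch property implies polyconvexity\<close>

theorem propositionB2:
  fixes W :: "real^2^2 \<Rightarrow> real" and p :: real
  assumes "p \<ge> 2"
    and "conformally_invariant W"
    and "groetzsch_property p W"
  shows "polyconvex W"
  using assms by (intro polyconvex_if_stretch_convex groetzsch_stretch_convex[of p]) auto

end
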